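(* For any integers $m,n,p$ with $m\geq n\geq 0$, $$\sum_{k=0}^{m}\mathrm{per}\begin{pmatrix} C_{n+k,2k} & C_{n+p+k,2k+1}\\ C_{m+k,2k} & C_{m+p+k,2k+1}\end{pmatrix}=C_{m+n+p,1}+F_{n,m}(p),$$ $$\sum_{k=0}^{m}\mathrm{per}\begin{pmatrix} C_{n+k,2k+1} & C_{n+p+k+1,2k+2}\\ C_{m+k,2k+1} & C_{m+p+k+1,2k+2}\end{pmatrix}=C_{m+n+p,1}+F_{n,m}(p),$$ where $$F_{n,m}(p)=\begin{cases}\sum_{i=0}^{p-1}C_{n+i}C_{m+p-i-1}, & \text{if } p\geq 1,\\ 0, & \text{if } p=0,\\ -\sum_{i=1}^{|p|}C_{n-i}C_{m-|p|+i-1}, & \text{if } p\leq -1.\end{cases}$$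
   Context: $\mathrm{per}$ denotes the permanent; for a $2\times 2$ matrix, $\mathrm{per}\begin{pmatrix}a&b\\c&d\end{pmatrix}=ad+bc$. $C_n=\frac{1}{n+1}\binom{2n}{n}$ is the $n$th Catalan number. For integers $n\geq k\geq 0$, $C_{n,k}=\frac{k+1}{n+1}\binom{2n-k}{n}$ (ballot numbers); these are the entries of an infinite lower triangular matrix, so $C_{n,k}=0$ for $k>n$.
   Formalization: The second identity is stated only for n ≥ 1 or m+p ≤ 0. It is false in all other cases (n = 0, m+p ≥ 1): for m = n = 0, p = 1 its left side is 0 and its right side is 2. *)

theory Defs
  imports "HOL-Analysis.Analysis"
begin

definition per :: "'a::comm_semiring_1 ^ 'n ^ 'n \<Rightarrow> 'a" where
  "per A = (\<Sum>\<sigma> | \<sigma> permutes (UNIV :: 'n set). \<Prod>i\<in>UNIV. A $ i $ \<sigma> i)"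

lemma per_2x2: "per (vector [vector [a, b], vector [c, d]] :: 'a::comm_semiring_1 ^ 2 ^ 2) = a * d + b * c"
proof -
  have f12: "finite {2::2}" "1 \<notin> {2::2}" by auto
  show ?thesis
    unfolding per_def UNIV_2
    unfolding sum_over_permutations_insert[OF f12]
    unfolding permutes_sing
    by (simp add: transpose_def)
qed

text \<open>
  The arguments of the two sequences below are integers, because the shift \<open>p\<close> in the
  theorem may be negative. Both are extended by 0: the ballot numbers form
  a lower triangular array with rows and columns indexed by the nonnegative integers, and the
  Catalan numbers are its column 0.
\<close>

definition catalan :: "int \<Rightarrow> real" where
  "catalan n = (if 0 \<le> n then 1 / of_int (n + 1) * of_nat (nat (2 * n) choose nat n) else 0)"

definition ballot :: "int \<Rightarrow> int \<Rightarrow> real" where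
  "ballot n k =
    (if 0 \<le> k \<and> k \<le> n
     then of_int (k + 1) / of_int (n + 1) * of_nat (nat (2 * n - k) choose nat n)
     else 0)"

definition F :: "int \<Rightarrow> int \<Rightarrow> int \<Rightarrow> real" where
  "F n m p =
    (if p \<ge> 1 then (\<Sum>i = 0..p - 1. catalan (n + i) * catalan (m + p - i - 1))
     else if p = 0 then 0
     else - (\<Sum>i = 1..\<bar>p\<bar>. catalan (n - i) * catalan (m - \<bar>p\<bar> + i - 1)))"

text \<open>
  The second identity of the theorem is stated under the extra hypothesis
  \<open>n \<ge> 1 \<or> m + p \<le> 0\<close>, since it fails for all other \<open>n\<close>, \<open>m\<close>, \<open>p\<close> with
  \<open>m \<ge> n \<ge> 0\<close>. For \<open>m = n = 0\<close> and \<open>p = 1\<close>, its left-hand side is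
  \<open>2 * ballot 0 1 * ballot 2 2 = 0\<close>, and its right-hand side is
  \<open>ballot 1 1 + catalan 0 * catalan 0 = 2\<close>:
\<close>

lemma second_identity_fails:
  "(\<Sum>k = 0..0. per (vector [vector [ballot (0 + k) (2 * k + 1), ballot (0 + 1 + k + 1) (2 * k + 2)],
                             vector [ballot (0 + k) (2 * k + 1), ballot (0 + 1 + k + 1) (2 * k + 2)]]
                       :: real ^ 2 ^ 2))
    \<noteq> ballot (0 + 0 + 1) 1 + F 0 0 1"
  by (simp add: per_2x2 ballot_def catalan_def F_def)

end

theory Submission
  imports Defs
begin

text \<open>
  The number \<open>ballot n k\<close> counts the lattice paths with steps \<open>+1\<close> and \<open>-1\<close> that
  start at height 0, never go below it, and end at height \<open>k\<close> after \<open>2n - k\<close> steps.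
  Write \<open>a N h\<close> for the number of such paths with \<open>N\<close> steps and final height \<open>h\<close>, which is
  0 for negative \<open>N\<close>.
  Then both left-hand sides are made of sums of the shape
  \<open>S A B = (\<Sum>h. a A h * a B (h + 1))\<close>: the first is
  \<open>S (2n) (2m+2p-1) + S (2m) (2n+2p-1)\<close>, the second is
  \<open>S (2n-1) (2m+2p) + S (2m-1) (2n+2p)\<close>.

  Expanding the last step of one path on each side gives
  \<open>S A (B + 1) - S (A + 1) B = a A 0 * a B 0\<close>, because the step operator is symmetric up to
  a boundary term at height 0. That boundary term vanishes when \<open>A\<close> is odd, which identifies the
  two left-hand sides for \<open>n \<ge> 1\<close> (\<open>even_pairing_eq_odd_pairing\<close>), and it is a product of two Catalan
  numbers when \<open>A\<close> and \<open>B\<close> are even (\<open>even_pairing_step\<close>). Moving all steps to the second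
  path, with \<open>M = m + n + p\<close>, yields (\<open>even_pairing_closed_form\<close>)
  \<open>S (2n) (2m+2p-1) = ballot M 1 - (\<Sum>i<n. C i * C (M-1-i))\<close>.

  Adding the formula with \<open>n\<close> and \<open>m\<close> exchanged gives \<open>2 * ballot M 1\<close> minus two partial
  sums of the Catalan convolution, whose full value is \<open>ballot M 1\<close>. Reflecting
  \<open>i \<mapsto> M-1-i\<close> in one of them turns \<open>ballot M 1\<close> minus the two partial sums into the
  terms between \<open>n\<close> and \<open>n + p\<close>, counted with the sign of \<open>p\<close>, and this is \<open>F n m p\<close>.
\<close>

section \<open>Ballot numbers\<close>

lemma ballot_eq_0: "k < 0 \<or> n < k \<Longrightarrow> ballot n k = 0"
  by (auto simp: ballot_def)

lemma ballot_0_eq_catalan: "ballot n 0 = catalan n"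
  by (simp add: ballot_def catalan_def)

text \<open>
  This is the count given by the reflection principle. The range of \<open>k\<close> includes \<open>-1\<close> and
  \<open>n + 1\<close>, where both sides vanish, so that Pascal's rule proves
  \<open>ballot_recurrence\<close> without separate boundary cases.
\<close>
lemma ballot_eq_diff:
  assumes "n \<ge> 0" "k \<ge> - 1" "k \<le> 2 * n"
  shows "ballot n k = of_nat (nat (2 * n - k) choose nat n) - of_nat (nat (2 * n - k) choose Suc (nat n))"
proof -
  obtain r where r: "n = int r"
    using assms(1) nonneg_int_cases by blast
  obtain N where N: "2 * n - k = int N"
    using assms(3) by (metis diff_ge_0_iff_ge nonneg_int_cases)
  have nat_N: "nat (2 * n - k) = N" and nat_r: "nat n = r"
    using r N by simp_all
  have k: "k = 2 * int r - int N"
    using r N by simp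
  have absorb: "real (N choose Suc r) * (real r + 1) = real (N choose r) * (real N - real r)"
  proof (cases "r \<le> N")
    case True
    have "Suc r * (N choose Suc r) = (N - r) * (N choose r)"
      by (metis binomial_absorb_comp binomial_absorption)
    then have "real (Suc r * (N choose Suc r)) = real ((N - r) * (N choose r))"
      by simp
    then show ?thesis
      using True by (simp add: of_nat_diff algebra_simps)
  qed (simp add: binomial_eq_0)
  have quotient: "real (N choose r) - real (N choose Suc r)
      = (real_of_int k + 1) / (real_of_int n + 1) * real (N choose r)"
    using absorb by (simp add: k r field_simps)
  show ?thesis
  proof (cases "0 \<le> k \<and> k \<le> n")
    case True
    then show ?thesis
      using quotient unfolding ballot_def nat_N nat_r by simp
  next
    case False
    \<comment> \<open>either the factor \<open>k + 1\<close> is 0, or \<open>N < r\<close>\<close>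
    then have "k = - 1 \<or> N < r"
      using assms k r by linarith
    then have "real (N choose r) - real (N choose Suc r) = 0"
      using quotient by (auto simp: binomial_eq_0)
    then show ?thesis
      using False unfolding ballot_def nat_N nat_r by auto
  qed
qed

text \<open>
  The last step of a path leads up from height \<open>k - 1\<close> or down from height \<open>k + 1\<close>. Only the
  empty path, which has \<open>n = k = 0\<close>, has no last step.
\<close>
lemma ballot_recurrence:
  assumes "k \<ge> 0" "n \<noteq> 0 \<or> k \<noteq> 0"
  shows "ballot n k = ballot (n - 1) (k - 1) + ballot n (k + 1)"
proof (cases "k \<le> n")
  case True
  then have n: "n \<ge> 1"
    using assms by linarith
  obtain s where s: "n = int (Suc s)"
    using n by (metis nonneg_int_cases Suc_diff_1 diff_ge_0_iff_ge int_ops(4) add.commute diff_add_cancel)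
  define N where "N = nat (2 * n - k - 1)"
  have N: "nat (2 * n - k) = Suc N" "nat (2 * (n - 1) - (k - 1)) = N" "nat (2 * n - (k + 1)) = N"
    using n True by (simp_all add: N_def algebra_simps)
  have s': "nat n = Suc s" "nat (n - 1) = s"
    using s by auto
  have "ballot n k = of_nat (Suc N choose Suc s) - of_nat (Suc N choose Suc (Suc s))"
       "ballot (n - 1) (k - 1) = of_nat (N choose s) - of_nat (N choose Suc s)"
       "ballot n (k + 1) = of_nat (N choose Suc s) - of_nat (N choose Suc (Suc s))"
    using ballot_eq_diff[of n k] ballot_eq_diff[of "n - 1" "k - 1"] ballot_eq_diff[of n "k + 1"]
      assms(1) n True unfolding N s' by auto
  then show ?thesis
    by simp
qed (use assms in \<open>simp add: ballot_eq_0\<close>)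

section \<open>Pairings of ballot numbers\<close>

text \<open>
  With \<open>S\<close> as in the introduction, these are \<open>S (2n) (2q-1)\<close> and \<open>S (2n-1) (2q)\<close>. The
  summation bound \<open>K\<close> is a parameter of its own because the theorem sums up to the larger of
  \<open>n\<close> and \<open>m\<close> in both halves of the permanent; the values agree for all \<open>K \<ge> n\<close>.
\<close>
definition even_pairing :: "int \<Rightarrow> int \<Rightarrow> int \<Rightarrow> real" where
  "even_pairing K n q = (\<Sum>k = 0..K. ballot (n + k) (2 * k) * ballot (q + k) (2 * k + 1))"

definition odd_pairing :: "int \<Rightarrow> int \<Rightarrow> int \<Rightarrow> real" where
  "odd_pairing K n q = (\<Sum>k = 0..K. ballot (n + k) (2 * k + 1) * ballot (q + k + 1) (2 * k + 2))"

lemma int_sum_telescope: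
  fixes f :: "int \<Rightarrow> 'a::ab_group_add"
  assumes "K \<ge> 0"
  shows "(\<Sum>k = 0..K. f k - f (k + 1)) = f 0 - f (K + 1)"
  using assms
proof (induction K rule: int_ge_induct)
  case (step i)
  have "{0..i + 1} = insert (i + 1) {0..i}"
    using step.hyps by auto
  then show ?case
    using step.IH by simp
qed simp

text \<open>
  The shift \<open>S A (B + 1) = S (A + 1) B\<close> for odd \<open>A\<close>: a path of odd length does not end at
  height 0, so the boundary term is \<open>ballot (n - 1) (- 1) = 0\<close>.
\<close>
lemma even_pairing_eq_odd_pairing:
  assumes "1 \<le> n" "n \<le> K"
  shows "even_pairing K n q = odd_pairing K n q"
proof -
  define f where "f k = ballot (n + k - 1) (2 * k - 1) * ballot (q + k) (2 * k + 1)" for k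
  have "ballot (n + k) (2 * k) * ballot (q + k) (2 * k + 1)
      - ballot (n + k) (2 * k + 1) * ballot (q + k + 1) (2 * k + 2) = f k - f (k + 1)"
    if "k \<in> {0..K}" for k
  proof -
    have "ballot (n + k) (2 * k) = ballot (n + k - 1) (2 * k - 1) + ballot (n + k) (2 * k + 1)"
      using ballot_recurrence[of "2 * k" "n + k"] that assms by simp
    moreover have "ballot (q + k + 1) (2 * k + 2) = ballot (q + k) (2 * k + 1) + ballot (q + k + 1) (2 * k + 3)"
      using ballot_recurrence[of "2 * k + 2" "q + k + 1"] that by (simp add: algebra_simps)
    ultimately show ?thesis
      by (simp add: f_def algebra_simps)
  qed
  then have "even_pairing K n q - odd_pairing K n q = (\<Sum>k = 0..K. f k - f (k + 1))"
    unfolding even_pairing_def odd_pairing_def sum_subtractf[symmetric]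
    by (intro sum.cong) auto
  also have "\<dots> = f 0 - f (K + 1)"
    using assms by (intro int_sum_telescope) simp
  also have "\<dots> = 0"
    using assms by (simp add: f_def ballot_eq_0)
  finally show ?thesis
    by simp
qed

text \<open>
  The shift \<open>S (A + 1) B = S A (B + 1) - a A 0 * a B 0\<close> for \<open>A = 2n\<close> and \<open>B = 2q\<close>,
  preceded by the shift from \<open>S (2n+2) (2q-1)\<close> to \<open>S (2n+1) (2q)\<close>.
\<close>
lemma even_pairing_step:
  assumes "0 \<le> n" "n + 1 \<le> K"
  shows "even_pairing K (n + 1) q = even_pairing K n (q + 1) - catalan n * catalan q"
proof -
  define f where "f k = ballot (n + k) (2 * k) * ballot (q + k) (2 * k)" for k
  have "ballot (n + k) (2 * k) * ballot (q + 1 + k) (2 * k + 1)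
      - ballot (n + 1 + k) (2 * k + 1) * ballot (q + k + 1) (2 * k + 2) = f k - f (k + 1)"
    if "k \<in> {0..K}" for k
  proof -
    have "ballot (x + 1 + k) (2 * k + 1) = ballot (x + k) (2 * k) + ballot (x + k + 1) (2 * k + 2)" for x
      using ballot_recurrence[of "2 * k + 1" "x + 1 + k"] that by (simp add: algebra_simps)
    from this[of n] this[of q] show ?thesis
      by (simp add: f_def algebra_simps)
  qed
  then have "even_pairing K n (q + 1) - odd_pairing K (n + 1) q = (\<Sum>k = 0..K. f k - f (k + 1))"
    unfolding even_pairing_def odd_pairing_def sum_subtractf[symmetric]
    by (intro sum.cong) auto
  also have "\<dots> = f 0 - f (K + 1)"
    using assms by (intro int_sum_telescope) simp
  also have "\<dots> = catalan n * catalan q"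
    using assms by (simp add: f_def ballot_eq_0 ballot_0_eq_catalan)
  finally show ?thesis
    using even_pairing_eq_odd_pairing[of "n + 1" K q] assms by simp
qed

section \<open>Partial sums of the Catalan convolution\<close>

definition catalan_conv :: "int \<Rightarrow> int \<Rightarrow> real" where
  "catalan_conv M x = (\<Sum>i = 0..<x. catalan i * catalan (M - 1 - i))"

lemma catalan_eq_0: "n < 0 \<Longrightarrow> catalan n = 0"
  by (simp add: catalan_def)

lemma catalan_conv_step:
  assumes "0 \<le> x"
  shows "catalan_conv M (x + 1) = catalan_conv M x + catalan x * catalan (M - 1 - x)"
proof -
  have "{0..<x + 1} = insert x {0..<x}"
    using assms by auto
  then show ?thesis
    by (simp add: catalan_conv_def)
qed

lemma catalan_conv_diff:
  assumes "x \<le> y"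
  shows "catalan_conv M y - catalan_conv M x = (\<Sum>i = x..<y. catalan i * catalan (M - 1 - i))"
proof -
  let ?g = "\<lambda>i. catalan i * catalan (M - 1 - i)"
  \<comment> \<open>terms with a negative index vanish, so both partial sums may start at a common
    lower bound, whatever the signs of \<open>x\<close> and \<open>y\<close>\<close>
  define l where "l = min 0 x"
  have l: "catalan_conv M z = sum ?g {l..<z}" for z
    unfolding catalan_conv_def
    by (rule sum.mono_neutral_left) (auto simp: l_def catalan_eq_0)
  have "{l..<y} = {l..<x} \<union> {x..<y}"
    using assms by (auto simp: l_def)
  then have "sum ?g {l..<y} = sum ?g {l..<x} + sum ?g {x..<y}"
    by (simp add: sum.union_disjoint ivl_disj_int)
  then show ?thesis
    by (simp add: l)
qed

lemma even_pairing_0_left: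
  assumes "0 \<le> K"
  shows "even_pairing K 0 q = ballot q 1"
proof -
  have "even_pairing K 0 q = (\<Sum>k \<in> {0}. ballot (0 + k) (2 * k) * ballot (q + k) (2 * k + 1))"
    unfolding even_pairing_def using assms
    by (intro sum.mono_neutral_right) (auto simp: ballot_eq_0)
  then show ?thesis
    by (simp add: ballot_def)
qed

lemma even_pairing_eq_0:
  assumes "q \<le> 0"
  shows "even_pairing K n q = 0"
  using assms by (simp add: even_pairing_def ballot_eq_0)

lemma odd_pairing_eq_0:
  assumes "q \<le> 0"
  shows "odd_pairing K n q = 0"
  using assms by (simp add: odd_pairing_def ballot_eq_0)

text \<open>
  All steps are moved from the first path to the second one, which then is any path from
  0 to 1.
\<close>
lemma even_pairing_closed_form:
  assumes "0 \<le> n" "n \<le> K"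
  shows "even_pairing K n q = ballot (n + q) 1 - catalan_conv (n + q) n"
  using assms
proof (induction n arbitrary: q rule: int_ge_induct)
  case base
  then show ?case
    by (simp add: even_pairing_0_left catalan_conv_def)
next
  case (step n)
  have "even_pairing K (n + 1) q
      = ballot (n + (q + 1)) 1 - catalan_conv (n + (q + 1)) n - catalan n * catalan q"
    using step by (simp add: even_pairing_step)
  then show ?case
    using catalan_conv_step[of n "n + 1 + q"] step.hyps by (simp add: algebra_simps)
qed

text \<open>
  Segner's recurrence: \<open>ballot M 1\<close> is the Catalan number of \<open>M\<close> for \<open>M \<ge> 1\<close>. The
  right-hand side is what is subtracted in the closed form of \<open>even_pairing M M 0\<close>, a pairing that
  is 0 because its second factors \<open>ballot k (2k+1)\<close> are.
\<close>
lemma ballot_1_eq_catalan_conv: "ballot M 1 = catalan_conv M M"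
proof (cases "0 \<le> M")
  case True
  then show ?thesis
    using even_pairing_closed_form[of M M 0] even_pairing_eq_0[of 0 M M] by simp
qed (simp add: ballot_eq_0 catalan_conv_def)

lemma catalan_conv_reflect: "catalan_conv M x + catalan_conv M (M - x) = catalan_conv M M"
proof -
  have reflect: "catalan_conv M (M - x) = catalan_conv M M - catalan_conv M x" if "x \<le> M" for x
  proof -
    have "catalan_conv M (M - x) = (\<Sum>i = x..<M. catalan i * catalan (M - 1 - i))"
      unfolding catalan_conv_def
      by (rule sum.reindex_bij_witness[of _ "\<lambda>i. M - 1 - i" "\<lambda>i. M - 1 - i"]) auto
    then show ?thesis
      using catalan_conv_diff[OF that] by simp
  qed
  show ?thesis
  proof (cases "x \<le> M")
    case True
    then show ?thesis
      using reflect by simp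
  next
    case False
    \<comment> \<open>the terms from \<open>M\<close> on have a negative second index\<close>
    then have "catalan_conv M x - catalan_conv M M = 0"
      by (subst catalan_conv_diff) (auto simp: catalan_eq_0)
    then show ?thesis
      using False by (simp add: catalan_conv_def)
  qed
qed

text \<open>The case distinction in \<open>F\<close> is that of a sum from \<open>n\<close> to \<open>n + p\<close> with orientation.\<close>
lemma F_eq_catalan_conv_diff:
  "F n m p = catalan_conv (m + n + p) (n + p) - catalan_conv (m + n + p) n"
proof -
  let ?g = "\<lambda>i. catalan i * catalan (m + n + p - 1 - i)"
  consider "p \<ge> 1" | "p = 0" | "p < 0"
    by linarith
  then show ?thesis
  proof cases
    case 1
    have "F n m p = (\<Sum>i = 0..p - 1. catalan (n + i) * catalan (m + p - i - 1))"
      using 1 by (simp add: F_def)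
    also have "\<dots> = sum ?g {n..<n + p}"
      by (rule sum.reindex_bij_witness[of _ "\<lambda>j. j - n" "\<lambda>i. n + i"]) (auto simp: algebra_simps)
    finally show ?thesis
      using 1 by (simp add: catalan_conv_diff)
  next
    case 2
    then show ?thesis
      by (simp add: F_def)
  next
    case 3
    then have "F n m p = - (\<Sum>i = 1..- p. catalan (n - i) * catalan (m + p + i - 1))"
      by (simp add: F_def)
    also have "(\<Sum>i = 1..- p. catalan (n - i) * catalan (m + p + i - 1)) = sum ?g {n + p..<n}"
      by (rule sum.reindex_bij_witness[of _ "\<lambda>j. n - j" "\<lambda>i. n - i"]) (auto simp: algebra_simps)
    finally show ?thesis
      using 3 catalan_conv_diff[of "n + p" n "m + n + p"] by simp
  qed
qed

section \<open>The permanent identities\<close>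

theorem theorem4p2:
  fixes m n p :: int
  assumes "m \<ge> n" and "n \<ge> 0"
  shows "(\<Sum>k = 0..m. per (vector
            [vector [ballot (n + k) (2 * k), ballot (n + p + k) (2 * k + 1)],
             vector [ballot (m + k) (2 * k), ballot (m + p + k) (2 * k + 1)]] :: real ^ 2 ^ 2))
          = ballot (m + n + p) 1 + F n m p
       \<and> (n \<ge> 1 \<or> m + p \<le> 0 \<longrightarrow>
         (\<Sum>k = 0..m. per (vector
            [vector [ballot (n + k) (2 * k + 1), ballot (n + p + k + 1) (2 * k + 2)],
             vector [ballot (m + k) (2 * k + 1), ballot (m + p + k + 1) (2 * k + 2)]] :: real ^ 2 ^ 2))
          = ballot (m + n + p) 1 + F n m p)"
    (is "?even = ?rhs \<and> (?hyp \<longrightarrow> ?odd = ?rhs)")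
proof -
  define M where "M = m + n + p"
  have even: "?even = even_pairing m n (m + p) + even_pairing m m (n + p)"
    by (simp add: per_2x2 even_pairing_def sum.distrib mult.commute)
  have odd: "?odd = odd_pairing m n (m + p) + odd_pairing m m (n + p)"
    by (simp add: per_2x2 odd_pairing_def sum.distrib mult.commute)
  have "even_pairing m n (m + p) = ballot M 1 - catalan_conv M n"
       "even_pairing m m (n + p) = ballot M 1 - catalan_conv M m"
    using even_pairing_closed_form[of n m "m + p"] even_pairing_closed_form[of m m "n + p"] assms
    by (simp_all add: M_def algebra_simps)
  moreover have "ballot M 1 = catalan_conv M m + catalan_conv M (n + p)"
    using catalan_conv_reflect[of M m] ballot_1_eq_catalan_conv[of M]
    by (simp add: M_def algebra_simps)
  ultimately have first: "?even = ?rhs"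
    using even F_eq_catalan_conv_diff[of n m p] by (simp add: M_def)
  have "?odd = ?even" if ?hyp
  proof (cases "n \<ge> 1")
    case True
    then show ?thesis
      unfolding even odd using assms by (simp add: even_pairing_eq_odd_pairing)
  next
    case False
    \<comment> \<open>no shift to paths of odd length is available for \<open>n = 0\<close>, but
      the second paths are too short to leave height 0 and all terms vanish\<close>
    then have "m + p \<le> 0" "n + p \<le> 0"
      using that assms by auto
    then show ?thesis
      unfolding even odd by (simp add: even_pairing_eq_0 odd_pairing_eq_0)
  qed
  with first show ?thesis
    by simp
qed

end
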